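(* Let $\alpha=m/n$ with $m,n$ relatively prime odd positive integers, let $\sigma\ge 0$ be an integer, let $\zeta_0$ be an integer, and let $\{r(\zeta)\}_{\zeta=\zeta_0}^{\infty}$, $\{q(\zeta)\}_{\zeta=\zeta_0}^{\infty}$ be real sequences such that $r(\zeta)>0$ for all $\zeta\ge\zeta_0$, $q(\zeta)\ge 0$ for all $\zeta\ge\zeta_0$, $q(\zeta)\neq 0$ for infinitely many $\zeta$, and $$\theta(\zeta):=\sum_{s=\zeta}^{\infty}\frac{1}{r^{1/\alpha}(s)}<\infty,\qquad \zeta\ge\zeta_0 .$$ If, for some integer $\zeta_1\ge\zeta_0$, $$\limsup_{\zeta\to\infty}\left(\theta^{\alpha}(\zeta)\sum_{s=\zeta_1}^{\zeta-1}q(s)\right)>1,$$ then the equation $$\Delta\big(r(\zeta)(\Delta x(\zeta))^{\alpha}\big)+q(\zeta)\,x^{\alpha}(\zeta-\sigma)=0,\qquad \zeta\ge\zeta_0,$$ oscillates.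
   Context: The variable $\zeta$ ranges over integers, and $\Delta x(\zeta)=x(\zeta+1)-x(\zeta)$ is the forward difference operator. For a sequence $f$, $f^{p}(\zeta)$ means $(f(\zeta))^{p}$. Since $\alpha$ is a quotient of odd positive integers, $t\mapsto t^{\alpha}$ and $t\mapsto t^{1/\alpha}$ are the real odd power functions on all of $\mathbb{R}$. The limsup may be $+\infty$. A solution of the equation is a non-trivial real sequence $\{x(\zeta)\}$ defined for $\zeta\ge\zeta_0-\sigma$ that satisfies the equation for all $\zeta\ge\zeta_0$. A solution oscillates if it is neither eventually positive nor eventually negative; the equation oscillates if all its solutions oscillate. *)

theory Defs
  imports "HOL-Library.Extended_Real" "HOL-Library.Liminf_Limsup"
begin

text \<open>The power \<open>t\<^sup>m\<^sup>/\<^sup>n\<close>. For odd \<open>n\<close>, \<^const>\<open>root\<close> is the inverse of \<open>t \<mapsto> t\<^sup>n\<close> on all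
  of the reals, so for odd \<open>m\<close> and \<open>n\<close> this is an odd function defined for negative \<open>t\<close> too
  (unlike \<open>powr\<close>). With \<open>\<alpha> = m/n\<close>, the power \<open>t\<^sup>1\<^sup>/\<^sup>\<alpha>\<close> is \<open>frac_pow n m t\<close>.\<close>
definition frac_pow :: "nat \<Rightarrow> nat \<Rightarrow> real \<Rightarrow> real" where
  "frac_pow m n t = root n t ^ m"

definition fwd_diff :: "(int \<Rightarrow> real) \<Rightarrow> int \<Rightarrow> real" where
  "fwd_diff x \<zeta> = x (\<zeta> + 1) - x \<zeta>"

text \<open>Sequences are total functions on \<^typ>\<open>int\<close>; only the values of \<open>x\<close> on \<open>\<zeta> \<ge> \<zeta>0 - \<sigma>\<close> and of
  \<open>r\<close>, \<open>q\<close> on \<open>\<zeta> \<ge> \<zeta>0\<close> enter the definitions below.\<close>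

definition is_solution ::
  "nat \<Rightarrow> nat \<Rightarrow> int \<Rightarrow> int \<Rightarrow> (int \<Rightarrow> real) \<Rightarrow> (int \<Rightarrow> real) \<Rightarrow> (int \<Rightarrow> real) \<Rightarrow> bool" where
  "is_solution m n \<sigma> \<zeta>0 r q x \<longleftrightarrow>
     (\<exists>\<zeta> \<ge> \<zeta>0 - \<sigma>. x \<zeta> \<noteq> 0) \<and>
     (\<forall>\<zeta> \<ge> \<zeta>0. fwd_diff (\<lambda>s. r s * frac_pow m n (fwd_diff x s)) \<zeta>
               + q \<zeta> * frac_pow m n (x (\<zeta> - \<sigma>)) = 0)"

definition seq_oscillates :: "(int \<Rightarrow> real) \<Rightarrow> bool" where
  "seq_oscillates x \<longleftrightarrow>
     \<not> eventually (\<lambda>\<zeta>. x \<zeta> > 0) at_top \<and> \<not> eventually (\<lambda>\<zeta>. x \<zeta> < 0) at_top"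

definition equation_oscillates ::
  "nat \<Rightarrow> nat \<Rightarrow> int \<Rightarrow> int \<Rightarrow> (int \<Rightarrow> real) \<Rightarrow> (int \<Rightarrow> real) \<Rightarrow> bool" where
  "equation_oscillates m n \<sigma> \<zeta>0 r q \<longleftrightarrow>
     (\<forall>x. is_solution m n \<sigma> \<zeta>0 r q x \<longrightarrow> seq_oscillates x)"

definition theta_term :: "nat \<Rightarrow> nat \<Rightarrow> (int \<Rightarrow> real) \<Rightarrow> int \<Rightarrow> real" where
  "theta_term m n r s = 1 / frac_pow n m (r s)"

text \<open>\<open>\<theta>(\<zeta>) = \<Sum>s\<ge>\<zeta>. 1 / r(s)\<^sup>1\<^sup>/\<^sup>\<alpha>\<close>, summed over \<open>s = \<zeta> + k\<close>, \<open>k = 0, 1, \<dots>\<close>; meaningful only when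
  the series is summable.\<close>
definition theta :: "nat \<Rightarrow> nat \<Rightarrow> (int \<Rightarrow> real) \<Rightarrow> int \<Rightarrow> real" where
  "theta m n r \<zeta> = (\<Sum>k. theta_term m n r (\<zeta> + int k))"

end

theory Submission
  imports Defs
begin

text \<open>
  Write \<open>t\<^sup>\<alpha>\<close> for \<open>frac_pow m n t\<close>. Suppose the equation has a non-oscillating solution \<open>x\<close>.
  The equation is odd in \<open>x\<close>, so \<open>x\<close> may be taken eventually positive. Then the flux
  \<open>y = r (\<Delta>x)\<^sup>\<alpha>\<close> satisfies \<open>\<Delta>y(\<zeta>) = - q(\<zeta>) x\<^sup>\<alpha>(\<zeta> - \<sigma>) \<le> 0\<close>, so it is nonincreasing and there
  are only two possibilities.

  If \<open>y\<close> stays nonnegative, \<open>x\<close> is nondecreasing, hence bounded below by some \<open>c > 0\<close>, and summing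
  the equation from \<open>a\<close> on gives \<open>c\<^sup>\<alpha> \<Sum> q \<le> y(a)\<close>: the partial sums of \<open>q\<close> are bounded
  (\<open>sum_le_if_flux_nonneg\<close>).

  If \<open>y\<close> becomes negative, \<open>x\<close> decreases from then on. Summing \<open>\<Delta>x(s) \<le> (y(\<zeta>)/r(s))\<^sup>1\<^sup>/\<^sup>\<alpha>\<close>
  over all \<open>s \<ge> \<zeta>\<close> and using \<open>x > 0\<close> at the far end gives \<open>x\<^sup>\<alpha>(\<zeta>) \<ge> - y(\<zeta>) \<theta>\<^sup>\<alpha>(\<zeta>)\<close>
  (\<open>flux_theta_le\<close>). Summing the equation instead, with \<open>x(s - \<sigma>) \<ge> x(\<zeta>)\<close>, gives
  \<open>- y(\<zeta>) \<ge> x\<^sup>\<alpha>(\<zeta>) \<Sum> q\<close>. Together, \<open>\<theta>\<^sup>\<alpha>(\<zeta>) \<Sum> q \<le> 1\<close> (\<open>theta_sum_le_if_flux_neg\<close>).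

  In both cases \<open>\<theta>\<^sup>\<alpha>(\<zeta>) \<Sum> q \<le> 1 + K \<theta>\<^sup>\<alpha>(\<zeta>)\<close> for large \<open>\<zeta>\<close>, where the constant \<open>K\<close> also absorbs
  the finitely many terms of \<open>q\<close> between the prescribed lower limit of summation and the point from
  which the estimates are valid (\<open>theta_sum_eventually_le\<close>). Since \<open>\<theta>\<close> is the tail of a
  convergent series, \<open>\<theta>\<^sup>\<alpha>(\<zeta>) \<longrightarrow> 0\<close>, and
  the limit superior cannot exceed 1.
\<close>

section \<open>Odd rational powers\<close>

lemma frac_pow_mult: "frac_pow m n (a * b) = frac_pow m n a * frac_pow m n b"
  by (simp add: frac_pow_def real_root_mult power_mult_distrib)

lemma frac_pow_divide: "frac_pow m n (a / b) = frac_pow m n a / frac_pow m n b"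
  by (simp add: frac_pow_def real_root_divide power_divide)

lemma frac_pow_minus: "odd m \<Longrightarrow> frac_pow m n (- t) = - frac_pow m n t"
  by (simp add: frac_pow_def real_root_minus)

lemma frac_pow_0: "odd m \<Longrightarrow> frac_pow m n 0 = 0"
  by (auto simp: frac_pow_def elim: oddE)

lemma frac_pow_inverse:
  assumes "odd m" "odd n"
  shows "frac_pow m n (frac_pow n m t) = t"
proof -
  have "root n (root m t ^ n) = root m t"
    using assms by (simp add: odd_real_root_power_cancel)
  then show ?thesis using assms by (simp add: frac_pow_def odd_real_root_pow)
qed

lemma frac_pow_mono:
  assumes "odd m" "odd n" "s \<le> t"
  shows "frac_pow m n s \<le> frac_pow m n t"
  using assms odd_pos[OF assms(2)] by (simp add: frac_pow_def power_mono_odd)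

text \<open>The converse direction is monotonicity of the inverse, which is again an odd rational power.\<close>
lemma frac_pow_le_iff:
  assumes "odd m" "odd n"
  shows "frac_pow m n s \<le> frac_pow m n t \<longleftrightarrow> s \<le> t"
  using frac_pow_mono[OF assms] frac_pow_mono[OF assms(2,1)]
  by (metis frac_pow_inverse[OF assms(2,1)])

lemma frac_pow_pos_iff: "odd m \<Longrightarrow> odd n \<Longrightarrow> 0 < frac_pow m n t \<longleftrightarrow> 0 < t"
  using frac_pow_le_iff[of m n t 0] by (simp add: frac_pow_0 not_le[symmetric])

lemma frac_pow_nonneg_iff: "odd m \<Longrightarrow> odd n \<Longrightarrow> 0 \<le> frac_pow m n t \<longleftrightarrow> 0 \<le> t"
  using frac_pow_le_iff[of m n 0 t] by (simp add: frac_pow_0)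

lemma tendsto_frac_pow_0:
  assumes "odd m" and "(f \<longlongrightarrow> 0) F"
  shows "((\<lambda>z. frac_pow m n (f z)) \<longlongrightarrow> 0) F"
proof -
  have "((\<lambda>z. root n (f z) ^ m) \<longlongrightarrow> root n 0 ^ m) F"
    by (intro tendsto_power tendsto_real_root assms)
  then show ?thesis
    unfolding frac_pow_def[symmetric] frac_pow_0[OF assms(1)] .
qed

section \<open>Forward differences\<close>

lemma sum_fwd_diff:
  assumes "a \<le> z"
  shows "(\<Sum>s = a..z - 1. fwd_diff f s) = f z - f a"
  using assms
proof (induction z rule: int_ge_induct)
  case base
  then show ?case by simp
next
  case (step i)
  then have "{a..i + 1 - 1} = insert i {a..i - 1}" by auto
  with step show ?case by (simp add: fwd_diff_def)
qed

lemma fwd_diff_nonpos_imp_le: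
  assumes "\<And>s. s \<ge> a \<Longrightarrow> fwd_diff f s \<le> 0" and "a \<le> z"
  shows "f z \<le> f a"
  using sum_fwd_diff[OF assms(2), of f] sum_nonpos[of "{a..z - 1}" "fwd_diff f"] assms(1) by simp

lemma fwd_diff_nonneg_imp_le:
  assumes "\<And>s. s \<ge> a \<Longrightarrow> fwd_diff f s \<ge> 0" and "a \<le> z"
  shows "f a \<le> f z"
  using sum_fwd_diff[OF assms(2), of f] sum_nonneg[of "{a..z - 1}" "fwd_diff f"] assms(1) by simp

section \<open>Eventually positive solutions\<close>

locale half_linear =
  fixes m n :: nat and \<sigma> \<zeta>0 :: int and r q :: "int \<Rightarrow> real"
  assumes odd_m: "odd m" and odd_n: "odd n"
    and sigma_nonneg: "\<sigma> \<ge> 0"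
    and r_pos: "\<zeta> \<ge> \<zeta>0 \<Longrightarrow> r \<zeta> > 0"
    and q_nonneg: "\<zeta> \<ge> \<zeta>0 \<Longrightarrow> q \<zeta> \<ge> 0"
    and theta_summable: "\<zeta> \<ge> \<zeta>0 \<Longrightarrow> summable (\<lambda>k. theta_term m n r (\<zeta> + int k))"
begin

abbreviation P :: "real \<Rightarrow> real" where "P \<equiv> frac_pow m n"
abbreviation \<theta> :: "int \<Rightarrow> real" where "\<theta> \<equiv> theta m n r"

lemma theta_term_nonneg: "s \<ge> \<zeta>0 \<Longrightarrow> theta_term m n r s \<ge> 0"
  using frac_pow_pos_iff[OF odd_n odd_m, of "r s"] r_pos[of s] by (simp add: theta_term_def)

lemma theta_nonneg: "z \<ge> \<zeta>0 \<Longrightarrow> \<theta> z \<ge> 0"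
  unfolding theta_def by (intro suminf_nonneg theta_summable theta_term_nonneg) auto

lemma fwd_diff_theta:
  assumes "z \<ge> \<zeta>0"
  shows "fwd_diff \<theta> z = - theta_term m n r z"
  using suminf_split_head[OF theta_summable[OF assms]]
  by (simp add: fwd_diff_def theta_def algebra_simps)

lemma theta_tendsto_0: "(\<theta> \<longlongrightarrow> 0) at_top"
proof -
  have tail: "(\<lambda>k. \<Sum>i. theta_term m n r (\<zeta>0 + int (i + k))) \<longlonglongrightarrow> 0"
    using suminf_exist_split[OF _ theta_summable[of \<zeta>0]] by (simp add: LIMSEQ_iff)
  have "filterlim (\<lambda>z. nat (z - \<zeta>0)) sequentially at_top"
    unfolding filterlim_at_top
  proof
    fix k
    show "\<forall>\<^sub>F z in at_top. k \<le> nat (z - \<zeta>0)"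
      using eventually_ge_at_top[of "\<zeta>0 + int k"] by eventually_elim linarith
  qed
  from filterlim_compose[OF tail this]
  have "((\<lambda>z. \<Sum>i. theta_term m n r (\<zeta>0 + int (i + nat (z - \<zeta>0)))) \<longlongrightarrow> 0) at_top" .
  moreover have "\<forall>\<^sub>F z in at_top. (\<Sum>i. theta_term m n r (\<zeta>0 + int (i + nat (z - \<zeta>0)))) = \<theta> z"
    using eventually_ge_at_top[of \<zeta>0]
    by eventually_elim (auto simp: theta_def add.commute intro!: suminf_cong)
  ultimately show ?thesis by (rule Lim_transform_eventually)
qed

lemma frac_pow_theta_tendsto_0: "((\<lambda>z. P (\<theta> z)) \<longlongrightarrow> 0) at_top"
  by (rule tendsto_frac_pow_0[OF odd_m theta_tendsto_0])

end

text \<open>Positivity starts at \<open>N - \<sigma>\<close> so that the delayed values occurring in the equation are positive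
  from time \<open>N\<close> on.\<close>
locale positive_solution = half_linear +
  fixes x :: "int \<Rightarrow> real" and N :: int
  assumes equation: "\<zeta> \<ge> \<zeta>0 \<Longrightarrow>
      fwd_diff (\<lambda>s. r s * P (fwd_diff x s)) \<zeta> + q \<zeta> * P (x (\<zeta> - \<sigma>)) = 0"
    and N_ge: "N \<ge> \<zeta>0"
    and x_pos: "s \<ge> N - \<sigma> \<Longrightarrow> x s > 0"
begin

definition flux :: "int \<Rightarrow> real" where "flux s = r s * P (fwd_diff x s)"

lemma fwd_diff_flux: "s \<ge> \<zeta>0 \<Longrightarrow> fwd_diff flux s = - (q s * P (x (s - \<sigma>)))"
  using equation[of s] unfolding flux_def[symmetric] by simp

lemma flux_antimono:
  assumes "N \<le> a" "a \<le> z"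
  shows "flux z \<le> flux a"
proof (rule fwd_diff_nonpos_imp_le[OF _ assms(2)])
  fix s assume "s \<ge> a"
  with assms have "s \<ge> N" by simp
  then have "q s * P (x (s - \<sigma>)) \<ge> 0"
    using N_ge x_pos[of "s - \<sigma>"] q_nonneg[of s] odd_m odd_n
    by (auto intro!: mult_nonneg_nonneg simp: frac_pow_nonneg_iff less_imp_le)
  then show "fwd_diff flux s \<le> 0"
    using fwd_diff_flux[of s] \<open>s \<ge> N\<close> N_ge by simp
qed

lemma flux_nonneg_iff: "s \<ge> \<zeta>0 \<Longrightarrow> 0 \<le> flux s \<longleftrightarrow> 0 \<le> fwd_diff x s"
  using r_pos[of s] by (simp add: flux_def zero_le_mult_iff frac_pow_nonneg_iff odd_m odd_n)

text \<open>The summed equation, with the delayed values of the solution replaced by a lower bound.\<close>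
lemma sum_q_le_flux_drop:
  assumes "\<zeta>0 \<le> a" "a \<le> z" and c: "\<And>s. a \<le> s \<Longrightarrow> s < z \<Longrightarrow> c \<le> x (s - \<sigma>)"
  shows "P c * (\<Sum>s = a..z - 1. q s) \<le> flux a - flux z"
proof -
  have "P c * (\<Sum>s = a..z - 1. q s) \<le> (\<Sum>s = a..z - 1. q s * P (x (s - \<sigma>)))"
    unfolding sum_distrib_left
  proof (rule sum_mono)
    fix s assume "s \<in> {a..z - 1}"
    then have "P c \<le> P (x (s - \<sigma>))" "q s \<ge> 0"
      using c[of s] q_nonneg[of s] assms(1) by (auto simp: frac_pow_le_iff odd_m odd_n)
    then show "P c * q s \<le> q s * P (x (s - \<sigma>))"
      by (metis mult.commute mult_left_mono)
  qed
  also have "\<dots> = - (\<Sum>s = a..z - 1. fwd_diff flux s)"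
    unfolding sum_negf[symmetric] using assms(1) by (intro sum.cong) (auto simp: fwd_diff_flux)
  also have "\<dots> = flux a - flux z"
    by (simp add: sum_fwd_diff[OF assms(2)])
  finally show ?thesis .
qed

text \<open>A nonnegative flux keeps \<open>x\<close> above \<open>x N > 0\<close>, and the flux, starting from a finite value,
  can pay for only a bounded total amount of \<open>q\<close>.\<close>
lemma sum_le_if_flux_nonneg:
  assumes nonneg: "\<And>s. s \<ge> N \<Longrightarrow> 0 \<le> flux s" and "z \<ge> N + \<sigma>"
  shows "(\<Sum>s = N + \<sigma>..z - 1. q s) \<le> flux (N + \<sigma>) / P (x N)"
proof -
  have "x N \<le> x (s - \<sigma>)" if "s \<ge> N + \<sigma>" for s
    using that N_ge nonneg flux_nonneg_iff by (intro fwd_diff_nonneg_imp_le) auto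
  then have "P (x N) * (\<Sum>s = N + \<sigma>..z - 1. q s) \<le> flux (N + \<sigma>) - flux z"
    using assms(2) N_ge sigma_nonneg by (intro sum_q_le_flux_drop) auto
  also have "\<dots> \<le> flux (N + \<sigma>)"
    using nonneg[of z] assms(2) sigma_nonneg by simp
  finally show ?thesis
    using x_pos[of N] sigma_nonneg by (simp add: pos_le_divide_eq frac_pow_pos_iff odd_m odd_n mult.commute)
qed

text \<open>From \<open>z\<close> onwards \<open>\<Delta>x(s)\<close> is at most \<open>c = flux(z)\<^sup>1\<^sup>/\<^sup>\<alpha>\<close> times the \<open>s\<close>-th term of the series
  for \<open>\<theta>\<close>; hence the total drop of \<open>x\<close> after \<open>z\<close> is at least \<open>- c \<theta>(z)\<close>. A positive \<open>x\<close> can drop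
  by at most \<open>x z\<close>.\<close>
lemma flux_theta_le:
  assumes "z \<ge> N"
  shows "- flux z * P (\<theta> z) \<le> P (x z)"
proof -
  define c where "c = frac_pow n m (flux z)"
  have P_c: "P c = flux z"
    unfolding c_def by (rule frac_pow_inverse[OF odd_m odd_n])
  have step: "fwd_diff (\<lambda>s. x s + c * \<theta> s) s \<le> 0" if "s \<ge> z" for s
  proof -
    have s: "s \<ge> \<zeta>0" using that assms N_ge by simp
    have "P (fwd_diff x s) \<le> flux z / r s"
      using flux_antimono[OF assms that] r_pos[OF s] by (simp add: flux_def pos_le_divide_eq mult.commute)
    also have "\<dots> = P (c * theta_term m n r s)"
      by (simp add: theta_term_def frac_pow_divide P_c frac_pow_inverse odd_m odd_n)
    finally have "fwd_diff x s \<le> c * theta_term m n r s"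
      by (simp add: frac_pow_le_iff odd_m odd_n)
    moreover have "fwd_diff (\<lambda>s. x s + c * \<theta> s) s = fwd_diff x s + c * fwd_diff \<theta> s"
      by (simp add: fwd_diff_def algebra_simps)
    ultimately show ?thesis
      by (simp add: fwd_diff_theta[OF s])
  qed
  have "c * \<theta> s \<le> x z + c * \<theta> z" if "s \<ge> z" for s
  proof -
    have "x s + c * \<theta> s \<le> x z + c * \<theta> z"
      using fwd_diff_nonpos_imp_le[OF step that] .
    moreover have "x s > 0" using that assms sigma_nonneg by (intro x_pos) simp
    ultimately show ?thesis by simp
  qed
  then have ev: "\<forall>\<^sub>F s in at_top. c * \<theta> s \<le> x z + c * \<theta> z"
    using eventually_ge_at_top[of z] by (rule eventually_mono[rotated])
  have lim: "((\<lambda>s. c * \<theta> s) \<longlongrightarrow> 0) at_top"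
    using tendsto_mult_left[OF theta_tendsto_0, of c] by simp
  have "0 \<le> x z + c * \<theta> z"
    by (rule tendsto_upperbound[OF lim ev]) simp
  then have "P (- (c * \<theta> z)) \<le> P (x z)"
    by (simp add: frac_pow_le_iff odd_m odd_n)
  then show ?thesis
    by (simp add: frac_pow_minus odd_m frac_pow_mult P_c)
qed

text \<open>Here \<open>x\<close> decreases, so its delayed values up to time \<open>z\<close> dominate \<open>x z\<close>; the summed
  equation bounds \<open>P (x z)\<close> times the sum of \<open>q\<close> by \<open>- flux z\<close>, the quantity that the previous
  lemma bounds from the other side. The factor \<open>P (x z)\<close> cancels.\<close>
lemma theta_sum_le_if_flux_neg:
  assumes "M \<ge> N" "flux M < 0" "z \<ge> M + \<sigma>"
  shows "P (\<theta> z) * (\<Sum>s = M + \<sigma>..z - 1. q s) \<le> 1"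
proof -
  let ?S = "\<Sum>s = M + \<sigma>..z - 1. q s"
  have neg: "flux s < 0" if "s \<ge> M" for s
    using flux_antimono[OF assms(1) that] assms(2) by simp
  have "x z \<le> x (s - \<sigma>)" if "M + \<sigma> \<le> s" "s < z" for s
  proof (rule fwd_diff_nonpos_imp_le)
    fix t assume "t \<ge> s - \<sigma>"
    then have "t \<ge> M" "t \<ge> \<zeta>0" using that assms(1) N_ge by auto
    then show "fwd_diff x t \<le> 0" using neg flux_nonneg_iff[of t] by (meson le_cases not_le)
  qed (use that sigma_nonneg in simp)
  then have "P (x z) * ?S \<le> flux (M + \<sigma>) - flux z"
    using assms N_ge sigma_nonneg by (intro sum_q_le_flux_drop) auto
  then have "P (x z) * ?S \<le> - flux z"
    using neg[of "M + \<sigma>"] sigma_nonneg by simp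
  moreover have "P (\<theta> z) \<ge> 0"
    using theta_nonneg[of z] assms N_ge sigma_nonneg by (simp add: frac_pow_nonneg_iff odd_m odd_n)
  ultimately have "P (\<theta> z) * (P (x z) * ?S) \<le> P (\<theta> z) * - flux z"
    by (rule mult_left_mono)
  also have "\<dots> \<le> P (x z)"
    using flux_theta_le[of z] assms sigma_nonneg by (simp add: mult.commute)
  finally have "P (x z) * (P (\<theta> z) * ?S) \<le> P (x z) * 1"
    by (simp add: algebra_simps)
  moreover have "P (x z) > 0"
    using x_pos[of z] assms sigma_nonneg by (simp add: frac_pow_pos_iff odd_m odd_n)
  ultimately show ?thesis by (simp only: mult_le_cancel_left_pos)
qed

text \<open>The two cases of the flux, with the sum of \<open>q\<close> extended down to \<open>\<zeta>1\<close>: both the bound on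
  \<open>\<Sum> q\<close> from the nonnegative case and the finitely many extra terms go into \<open>K\<close>.\<close>
lemma theta_sum_eventually_le:
  assumes "\<zeta>1 \<le> N"
  obtains K where "\<forall>\<^sub>F z in at_top. P (\<theta> z) * (\<Sum>s = \<zeta>1..z - 1. q s) \<le> 1 + K * P (\<theta> z)"
proof -
  obtain M L where M: "M \<ge> N"
    and L: "\<And>z. z \<ge> M \<Longrightarrow> P (\<theta> z) * (\<Sum>s = M..z - 1. q s) \<le> 1 + L * P (\<theta> z)"
  proof (cases "\<forall>s \<ge> N. 0 \<le> flux s")
    case True
    show thesis
    proof (rule that)
      show "N + \<sigma> \<ge> N" using sigma_nonneg by simp
      fix z assume z: "z \<ge> N + \<sigma>"
      have "P (\<theta> z) \<ge> 0"
        using theta_nonneg[of z] z N_ge sigma_nonneg by (simp add: frac_pow_nonneg_iff odd_m odd_n)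
      then have "P (\<theta> z) * (\<Sum>s = N + \<sigma>..z - 1. q s) \<le> P (\<theta> z) * (flux (N + \<sigma>) / P (x N))"
        using sum_le_if_flux_nonneg[OF _ z] True by (intro mult_left_mono) auto
      then show "P (\<theta> z) * (\<Sum>s = N + \<sigma>..z - 1. q s) \<le> 1 + flux (N + \<sigma>) / P (x N) * P (\<theta> z)"
        by (simp add: mult.commute)
    qed
  next
    case False
    then obtain M where "M \<ge> N" "flux M < 0" by (auto simp: not_le)
    then show thesis
      using theta_sum_le_if_flux_neg sigma_nonneg by (intro that[of "M + \<sigma>" 0]) auto
  qed
  let ?K = "(\<Sum>s = \<zeta>1..M - 1. q s) + L"
  have "\<forall>\<^sub>F z in at_top. P (\<theta> z) * (\<Sum>s = \<zeta>1..z - 1. q s) \<le> 1 + ?K * P (\<theta> z)"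
    using eventually_ge_at_top[of M]
  proof eventually_elim
    case (elim z)
    have "{\<zeta>1..z - 1} = {\<zeta>1..M - 1} \<union> {M..z - 1}"
      using assms M elim by auto
    then have "(\<Sum>s = \<zeta>1..z - 1. q s) = (\<Sum>s = \<zeta>1..M - 1. q s) + (\<Sum>s = M..z - 1. q s)"
      by (simp add: sum.union_disjoint)
    then show ?case using L[OF elim] by (simp add: algebra_simps)
  qed
  then show thesis by (rule that)
qed

lemma Limsup_theta_sum_le_1:
  assumes "\<zeta>1 \<le> N"
  shows "Limsup at_top (\<lambda>z. ereal (P (\<theta> z) * (\<Sum>s = \<zeta>1..z - 1. q s))) \<le> 1"
proof -
  obtain K where "\<forall>\<^sub>F z in at_top. P (\<theta> z) * (\<Sum>s = \<zeta>1..z - 1. q s) \<le> 1 + K * P (\<theta> z)"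
    using theta_sum_eventually_le[OF assms] .
  then have "Limsup at_top (\<lambda>z. ereal (P (\<theta> z) * (\<Sum>s = \<zeta>1..z - 1. q s)))
      \<le> Limsup at_top (\<lambda>z. ereal (1 + K * P (\<theta> z)))"
    by (intro Limsup_mono) simp
  also have "((\<lambda>z. 1 + K * P (\<theta> z)) \<longlongrightarrow> 1 + K * 0) at_top"
    by (intro tendsto_intros frac_pow_theta_tendsto_0)
  then have "Limsup at_top (\<lambda>z. ereal (1 + K * P (\<theta> z))) = 1"
    by (intro lim_imp_Limsup) (simp_all add: one_ereal_def)
  finally show ?thesis .
qed

end

section \<open>Oscillation\<close>

lemma (in half_linear) not_eventually_positive:
  assumes equation: "\<And>\<zeta>. \<zeta> \<ge> \<zeta>0 \<Longrightarrow>
      fwd_diff (\<lambda>s. r s * P (fwd_diff x s)) \<zeta> + q \<zeta> * P (x (\<zeta> - \<sigma>)) = 0"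
    and limsup: "Limsup at_top (\<lambda>z. ereal (P (\<theta> z) * (\<Sum>s = \<zeta>1..z - 1. q s))) > 1"
  shows "\<not> eventually (\<lambda>z. x z > 0) at_top"
proof
  assume "eventually (\<lambda>z. x z > 0) at_top"
  then obtain A where A: "\<And>s. s \<ge> A \<Longrightarrow> x s > 0"
    by (auto simp: eventually_at_top_linorder)
  define N where "N = max (A + \<sigma>) (max \<zeta>0 \<zeta>1)"
  interpret positive_solution m n \<sigma> \<zeta>0 r q x N
    by unfold_locales (auto simp: N_def intro: equation A)
  have "\<zeta>1 \<le> N" by (simp add: N_def)
  from Limsup_theta_sum_le_1[OF this] limsup show False by simp
qed

theorem theorem2p4:
  fixes m n :: nat and \<sigma> \<zeta>0 \<zeta>1 :: int and r q :: "int \<Rightarrow> real"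
  assumes "odd m" and "odd n" and "coprime m n"
    and "\<sigma> \<ge> 0"
    and "\<And>\<zeta>. \<zeta> \<ge> \<zeta>0 \<Longrightarrow> r \<zeta> > 0"
    and "\<And>\<zeta>. \<zeta> \<ge> \<zeta>0 \<Longrightarrow> q \<zeta> \<ge> 0"
    and "infinite {\<zeta>. \<zeta> \<ge> \<zeta>0 \<and> q \<zeta> \<noteq> 0}"
    and "\<And>\<zeta>. \<zeta> \<ge> \<zeta>0 \<Longrightarrow> summable (\<lambda>k. theta_term m n r (\<zeta> + int k))"
    and "\<zeta>1 \<ge> \<zeta>0"
    and "Limsup at_top
           (\<lambda>\<zeta>. ereal (frac_pow m n (theta m n r \<zeta>) * (\<Sum>s = \<zeta>1..\<zeta> - 1. q s))) > 1"
  shows "equation_oscillates m n \<sigma> \<zeta>0 r q"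
  unfolding equation_oscillates_def seq_oscillates_def
proof (intro allI impI conjI)
  interpret half_linear m n \<sigma> \<zeta>0 r q
    by unfold_locales (use assms in auto)
  fix x assume "is_solution m n \<sigma> \<zeta>0 r q x"
  then have eq: "fwd_diff (\<lambda>s. r s * P (fwd_diff x s)) \<zeta> + q \<zeta> * P (x (\<zeta> - \<sigma>)) = 0"
    if "\<zeta> \<ge> \<zeta>0" for \<zeta>
    using that by (simp add: is_solution_def)
  show "\<not> eventually (\<lambda>\<zeta>. x \<zeta> > 0) at_top"
    by (rule not_eventually_positive[OF eq assms(10)])
  have minus: "fwd_diff (\<lambda>s. - x s) s = - fwd_diff x s" for s
    by (simp add: fwd_diff_def)
  have "fwd_diff (\<lambda>s. r s * P (fwd_diff (\<lambda>s. - x s) s)) \<zeta> + q \<zeta> * P (- x (\<zeta> - \<sigma>)) = 0"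
    if "\<zeta> \<ge> \<zeta>0" for \<zeta>
  proof -
    have "fwd_diff (\<lambda>s. r s * P (- fwd_diff x s)) \<zeta> = - fwd_diff (\<lambda>s. r s * P (fwd_diff x s)) \<zeta>"
      unfolding frac_pow_minus[OF odd_m] by (simp add: fwd_diff_def)
    then show ?thesis
      using eq[OF that] unfolding minus by (simp add: frac_pow_minus odd_m)
  qed
  from not_eventually_positive[of "\<lambda>s. - x s", OF this assms(10)]
  show "\<not> eventually (\<lambda>\<zeta>. x \<zeta> < 0) at_top" by simp
qed

end
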